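(* As $n\to\infty$, $$|\mathrm{MSTD}(\mathbb{Z}/n\mathbb{Z})| \sim \begin{cases} 3^{n/2}, & \text{if } n \text{ is even},\\ \frac12\, n\, \varphi^n, & \text{if } n \text{ is odd},\end{cases}$$ where $\varphi = \frac{1+\sqrt5}{2}$.
   Context: For an abelian group $G$ and a subset $A\subset G$, let $A+A=\{a+b : a,b\in A\}$ and $A-A=\{a-b : a,b\in A\}$. A finite subset $A \subset G$ is an MSTD (more sums than differences) set if $|A+A| > |A-A|$. $\mathrm{MSTD}(G)$ denotes the collection of all MSTD sets $A\subset G$, and $|\mathrm{MSTD}(G)|$ the number of them. The notation $f_n \sim g_n$ means $f_n/g_n \to 1$ as $n\to\infty$. *)

theory Defs
  imports Complex_Main "HOL-Algebra.Elementary_Groups" "HOL-Library.Landau_Symbols"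
begin

text \<open>Abelian groups are the multiplicatively written groups of HOL-Algebra, so the sum
  \<open>a + b\<close> is \<open>a \<otimes> b\<close> and the difference \<open>a - b\<close> is \<open>a \<otimes> inv b\<close>.\<close>

definition sumset :: "('a, 'b) monoid_scheme \<Rightarrow> 'a set \<Rightarrow> 'a set" where
  "sumset G A = {a \<otimes>\<^bsub>G\<^esub> b | a b. a \<in> A \<and> b \<in> A}"

definition diffset :: "('a, 'b) monoid_scheme \<Rightarrow> 'a set \<Rightarrow> 'a set" where
  "diffset G A = {a \<otimes>\<^bsub>G\<^esub> inv\<^bsub>G\<^esub> b | a b. a \<in> A \<and> b \<in> A}"

definition MSTD :: "('a, 'b) monoid_scheme \<Rightarrow> 'a set set" where
  "MSTD G = {A. A \<subseteq> carrier G \<and> finite A \<and> card (sumset G A) > card (diffset G A)}"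

end

theory Submission
  imports Defs "HOL-Number_Theory.Fib" "HOL-Real_Asymp.Real_Asymp"
begin

text \<open>A residue \<open>d\<close> is missing from \<open>A - A\<close> exactly when no \<open>x \<in> A\<close> has \<open>x + d \<in> A\<close>, and \<open>s\<close> is missing from
\<open>A + A\<close> exactly when no \<open>x \<in> A\<close> has \<open>s - x \<in> A\<close>. Both conditions say that \<open>A\<close> is an independent set
in the graph of a permutation of \<open>\<int>/n\<int>\<close>: the translation by \<open>d\<close>, or the reflection at \<open>s\<close>. So
counting MSTD sets becomes counting independent sets, in three steps.

A single missing difference can be counted exactly. The graph of a translation by \<open>d\<close> of order \<open>m\<close>
consists of \<open>n/m\<close> cycles of length \<open>m\<close>, and a cycle has \<open>L\<^sub>m = \<phi>\<^sup>m + \<psi>\<^sup>m\<close> independent sets (a Lucas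
number; \<open>\<psi> = -1/\<phi>\<close>), which gives \<open>L\<^sub>m\<close> to the power \<open>n/m\<close> (\<open>card_avoiding_shift\<close>). For even \<open>n\<close>
the difference \<open>n/2\<close>, where \<open>m = 2\<close>, contributes \<open>3\<close> to the power \<open>n/2\<close>, and every other
difference only \<open>(5/3)\<^sup>n\<close> at most, where \<open>5/3 < \<surd>3\<close>. For odd \<open>n\<close> all \<open>m\<close> are odd, so each of the
\<open>(n-1)/2\<close> pairs \<open>\<plusminus>d\<close> contributes at most \<open>\<phi>\<^sup>n\<close>; the contribution is asymptotically \<open>\<phi>\<^sup>n\<close> unless
the order of \<open>d\<close> is small, and there are few such \<open>d\<close>.

A second missing difference or a missing sum is exponentially rare among the sets that miss \<open>d\<close>.
Take a point \<open>x\<close> and its partner \<open>y\<close> under the second permutation. Inside the window formed by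
\<open>x\<close>, \<open>y\<close> and their neighbours \<open>x \<plusminus> d\<close>, \<open>y \<plusminus> d\<close>, the set \<open>A\<close> may be replaced by \<open>{x, y}\<close>
without creating the difference \<open>d\<close>, whatever \<open>A\<close> is elsewhere; but the pattern \<open>{x, y}\<close> violates
the second condition. There are at most \<open>2\<^sup>6\<close> patterns in a window, so excluding this one removes at
least a fraction \<open>1/64\<close> of the sets, and linearly many disjoint windows can be treated one after the
other (\<open>card_avoiding_two_le\<close>). As the second condition can be chosen in only \<open>2n\<close> ways, almost every
set that misses \<open>d\<close> misses no other difference than \<open>\<plusminus>d\<close>, and no sum.

Finally, an MSTD set misses some difference, so their number is at most the sum over \<open>d \<le> n/2\<close> of the
counts for \<open>d\<close> (\<open>card_MSTD_le\<close>). Conversely, a set that misses a difference but no sum is MSTD, and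
the sets that miss only \<open>\<plusminus>d\<close> are disjoint for different \<open>d\<close>, which gives the same sum up to a factor
\<open>1 - o(1)\<close> as a lower bound (\<open>card_MSTD_ge\<close>).\<close>

section \<open>A second constraint is exponentially costly\<close>

text \<open>The independent sets of the graph on \<open>V\<close> that joins \<open>x\<close> to \<open>f x\<close>. A fixed point of \<open>f\<close> is a loop
and belongs to no such set, which is what a sum \<open>s = x + x\<close> requires.\<close>

definition avoiding :: "('a \<Rightarrow> 'a) \<Rightarrow> 'a set \<Rightarrow> 'a set set" where
  "avoiding f V = {A. A \<subseteq> V \<and> (\<forall>x\<in>A. f x \<notin> A)}"

lemma finite_avoiding: "finite V \<Longrightarrow> finite (avoiding f V)"
  by (rule finite_subset[of _ "Pow V"]) (auto simp: avoiding_def)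

text \<open>Treat the windows one by one. Overwriting window \<open>k\<close> with its pattern maps the sets that survived so
far to sets that also did (the windows are disjoint) and that now show the pattern in window \<open>k\<close>. At
most \<open>2\<^sup>w\<close> sets have the same image, since a set is determined by its image and its former trace on
the window. Hence at least a fraction \<open>1 / 2\<^sup>w\<close> of the survivors is lost to window \<open>k\<close>.\<close>

lemma card_avoiding_pattern_le:
  fixes S :: "'a set set"
  assumes "finite S" "finite K"
    and disj: "\<And>i j. i \<in> K \<Longrightarrow> j \<in> K \<Longrightarrow> i \<noteq> j \<Longrightarrow> W i \<inter> W j = {}"
    and W: "\<And>i. i \<in> K \<Longrightarrow> finite (W i) \<and> card (W i) \<le> w \<and> p i \<subseteq> W i"
    and closed: "\<And>i A. i \<in> K \<Longrightarrow> A \<in> S \<Longrightarrow> (A - W i) \<union> p i \<in> S"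
  shows "real (card {A \<in> S. \<forall>i\<in>K. A \<inter> W i \<noteq> p i}) \<le> (1 - 1 / 2 ^ w) ^ card K * real (card S)"
  using assms(2) disj W closed
proof (induction K rule: finite_induct)
  case empty
  then show ?case by simp
next
  case (insert k K)
  define T where "T = {A \<in> S. \<forall>i\<in>K. A \<inter> W i \<noteq> p i}"
  define T1 where "T1 = {A \<in> T. A \<inter> W k = p k}"
  define T0 where "T0 = {A \<in> T. A \<inter> W k \<noteq> p k}"
  have IH: "real (card T) \<le> (1 - 1 / 2 ^ w) ^ card K * real (card S)"
    unfolding T_def by (rule insert.IH) (use insert.prems in auto)
  have finT: "finite T" using \<open>finite S\<close> by (simp add: T_def)
  have Wk: "finite (W k)" "card (W k) \<le> w" "p k \<subseteq> W k" using insert.prems(2) by auto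
  define r where "r A = (A - W k) \<union> p k" for A
  have r: "r A \<in> T1" if "A \<in> T" for A
  proof -
    have "r A \<in> S" unfolding r_def using insert.prems(3)[of k A] that by (auto simp: T_def)
    moreover have "r A \<inter> W i = A \<inter> W i" if "i \<in> K" for i
    proof -
      have "W k \<inter> W i = {}" using insert.prems(1)[of k i] that insert.hyps by auto
      then show ?thesis using Wk(3) by (auto simp: r_def)
    qed
    moreover have "r A \<inter> W k = p k" using Wk(3) by (auto simp: r_def)
    ultimately show ?thesis using that by (auto simp: T1_def T_def)
  qed
  have "inj_on (\<lambda>A. (A \<inter> W k, r A)) T"
  proof (rule inj_onI)
    fix A B assume h: "(A \<inter> W k, r A) = (B \<inter> W k, r B)"
    have "A - W k = r A - W k" "B - W k = r B - W k" using Wk(3) by (auto simp: r_def)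
    with h show "A = B" by blast
  qed
  then have "card T \<le> card (Pow (W k) \<times> T1)"
    by (rule card_inj_on_le) (use r finT Wk in \<open>auto simp: T1_def\<close>)
  also have "\<dots> = 2 ^ card (W k) * card T1"
    by (simp add: card_cartesian_product card_Pow Wk)
  also have "\<dots> \<le> 2 ^ w * card T1"
    using Wk(2) by (intro mult_right_mono power_increasing) auto
  finally have "real (card T) \<le> 2 ^ w * real (card T1)"
    by (metis of_nat_mono of_nat_mult of_nat_numeral of_nat_power)
  moreover have "card T = card T0 + card T1"
  proof -
    have "T = T0 \<union> T1" "T0 \<inter> T1 = {}" by (auto simp: T0_def T1_def)
    then show ?thesis using finT card_Un_disjoint[of T0 T1] by auto
  qed
  ultimately have "real (card T0) \<le> (1 - 1 / 2 ^ w) * real (card T)"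
    by (simp add: field_simps)
  also have "\<dots> \<le> (1 - 1 / 2 ^ w) * ((1 - 1 / 2 ^ w) ^ card K * real (card S))"
    by (intro mult_left_mono IH) auto
  finally have "real (card T0) \<le> (1 - 1 / 2 ^ w) ^ card (insert k K) * real (card S)"
    using insert.hyps by simp
  moreover have "T0 = {A \<in> S. \<forall>i\<in>insert k K. A \<inter> W i \<noteq> p i}"
    by (auto simp: T0_def T_def)
  ultimately show ?case by simp
qed

text \<open>By maximality, every member meets some member of a maximal disjoint subfamily \<open>K\<close>, and each member of
\<open>K\<close> accounts for at most \<open>D\<close> of them.\<close>

lemma exists_large_disjoint_subfamily:
  fixes W :: "'i \<Rightarrow> 'a set"
  assumes "finite X"
    and ne: "\<And>x. x \<in> X \<Longrightarrow> W x \<noteq> {}"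
    and conflicts: "\<And>x. x \<in> X \<Longrightarrow> card {y \<in> X. W x \<inter> W y \<noteq> {}} \<le> D"
  obtains K where "K \<subseteq> X" "card X \<le> D * card K"
    "\<And>x y. x \<in> K \<Longrightarrow> y \<in> K \<Longrightarrow> x \<noteq> y \<Longrightarrow> W x \<inter> W y = {}"
proof -
  define F where "F = {K. K \<subseteq> X \<and> (\<forall>x\<in>K. \<forall>y\<in>K. x \<noteq> y \<longrightarrow> W x \<inter> W y = {})}"
  have "finite F" by (rule finite_subset[of _ "Pow X"]) (auto simp: F_def \<open>finite X\<close>)
  moreover have "{} \<in> F" by (auto simp: F_def)
  ultimately obtain K where K: "K \<in> F" and max: "\<And>L. L \<in> F \<Longrightarrow> K \<subseteq> L \<Longrightarrow> L = K"
    using finite_has_maximal[of F] by blast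
  have KX: "K \<subseteq> X" using K by (auto simp: F_def)
  then have "finite K" using \<open>finite X\<close> finite_subset by blast
  have "X \<subseteq> (\<Union>x\<in>K. {y \<in> X. W x \<inter> W y \<noteq> {}})"
  proof
    fix y assume y: "y \<in> X"
    show "y \<in> (\<Union>x\<in>K. {y \<in> X. W x \<inter> W y \<noteq> {}})"
    proof (rule ccontr)
      assume n: "y \<notin> (\<Union>x\<in>K. {y \<in> X. W x \<inter> W y \<noteq> {}})"
      then have "insert y K \<in> F" using K y by (auto simp: F_def)
      then have "y \<in> K" using max[of "insert y K"] by auto
      then show False using n ne[OF y] y by auto
    qed
  qed
  then have "card X \<le> card (\<Union>x\<in>K. {y \<in> X. W x \<inter> W y \<noteq> {}})"
    by (rule card_mono[rotated]) (use \<open>finite K\<close> \<open>finite X\<close> in auto)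
  also have "\<dots> \<le> (\<Sum>x\<in>K. card {y \<in> X. W x \<inter> W y \<noteq> {}})"
    by (rule card_UN_le[OF \<open>finite K\<close>])
  also have "\<dots> \<le> (\<Sum>x\<in>K. D)"
    by (rule sum_mono) (use conflicts KX in auto)
  finally have "card X \<le> D * card K" by (simp add: mult.commute)
  then show ?thesis using that[of K] KX K by (auto simp: F_def)
qed

text \<open>The permutation \<open>\<sigma>\<close> is given with its inverse \<open>\<tau>\<close>, and \<open>f\<close> with a left inverse. The window at \<open>x\<close>
consists of \<open>x\<close>, \<open>f x\<close> and their neighbours in the graph of \<open>\<sigma>\<close>, so the trace \<open>{x, f x}\<close> on it is
compatible with anything outside, provided that \<open>x\<close> and \<open>f x\<close> are distinct and not neighbours
themselves; at most \<open>b\<close> points fail this. A window has at most \<open>6\<close> points and each of them lies in at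
most \<open>6\<close> windows, so a window meets at most \<open>36\<close> windows, itself included, and at least
one window in \<open>36\<close> can be kept so that the kept ones are disjoint.\<close>

lemma card_avoiding_two_le:
  fixes V :: "'a set"
  assumes "finite V"
    and \<sigma>: "\<And>x. x \<in> V \<Longrightarrow> \<sigma> x \<in> V" "\<And>x. x \<in> V \<Longrightarrow> \<tau> x \<in> V"
      "\<And>x. x \<in> V \<Longrightarrow> \<tau> (\<sigma> x) = x" "\<And>x. x \<in> V \<Longrightarrow> \<sigma> (\<tau> x) = x"
    and f: "\<And>x. x \<in> V \<Longrightarrow> f x \<in> V" "\<And>x. x \<in> V \<Longrightarrow> g (f x) = x"
    and fix_free: "\<And>x. x \<in> V \<Longrightarrow> \<sigma> x \<noteq> x"
    and few: "card {x \<in> V. f x = x \<or> f x = \<sigma> x \<or> f x = \<tau> x} \<le> b"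
  shows "real (card (avoiding \<sigma> V \<inter> avoiding f V))
    \<le> (63 / 64) powr ((real (card V) - real b) / 36) * real (card (avoiding \<sigma> V))"
proof -
  define X where "X = {x \<in> V. f x \<noteq> x \<and> f x \<noteq> \<sigma> x \<and> f x \<noteq> \<tau> x}"
  define W where "W x = {x, \<sigma> x, \<tau> x, f x, \<sigma> (f x), \<tau> (f x)}" for x
  have card_six: "card {u1, u2, u3, u4, u5, u6} \<le> 6" for u1 u2 u3 u4 u5 u6 :: 'a
    by (intro order.trans[OF card_insert_le_m1]) auto
  have card_W: "card (W x) \<le> 6" for x
    unfolding W_def by (rule card_six)
  have "card V \<le> card X + b"
  proof -
    have "V = X \<union> {x \<in> V. f x = x \<or> f x = \<sigma> x \<or> f x = \<tau> x}" by (auto simp: X_def)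
    then have "card V \<le> card X + card {x \<in> V. f x = x \<or> f x = \<sigma> x \<or> f x = \<tau> x}"
      using card_Un_le[of X "{x \<in> V. f x = x \<or> f x = \<sigma> x \<or> f x = \<tau> x}"] by simp
    with few show ?thesis by linarith
  qed
  have conflict: "card {y \<in> X. W x \<inter> W y \<noteq> {}} \<le> 36" for x
  proof -
    \<comment> \<open>The base points of the windows through \<open>v\<close>, by the six roles that \<open>v\<close> can have in a window.\<close>
    define P where "P v = {v, \<tau> v, \<sigma> v, g v, g (\<tau> v), g (\<sigma> v)}" for v
    have "{y \<in> X. W x \<inter> W y \<noteq> {}} \<subseteq> (\<Union>v\<in>W x. P v)"
    proof
      fix y assume "y \<in> {y \<in> X. W x \<inter> W y \<noteq> {}}"
      then obtain v where v: "v \<in> W x" "v \<in> W y" "y \<in> V" by (auto simp: X_def)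
      have "y \<in> P v" using v(2,3) \<sigma> f unfolding W_def P_def by auto
      with v show "y \<in> (\<Union>v\<in>W x. P v)" by auto
    qed
    then have "card {y \<in> X. W x \<inter> W y \<noteq> {}} \<le> card (\<Union>v\<in>W x. P v)"
      by (rule card_mono[rotated]) (auto simp: W_def P_def)
    also have "\<dots> \<le> (\<Sum>v\<in>W x. card (P v))"
      by (rule card_UN_le) (auto simp: W_def)
    also have "\<dots> \<le> (\<Sum>v\<in>W x. 6)"
      unfolding P_def by (intro sum_mono card_six)
    also have "\<dots> \<le> 36" using card_W[of x] by simp
    finally show ?thesis .
  qed
  have "finite X" using \<open>finite V\<close> by (auto simp: X_def)
  then obtain K where K: "K \<subseteq> X" "card X \<le> 36 * card K"
    "\<And>x y. x \<in> K \<Longrightarrow> y \<in> K \<Longrightarrow> x \<noteq> y \<Longrightarrow> W x \<inter> W y = {}"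
    using exists_large_disjoint_subfamily[of X W 36] conflict by (auto simp: W_def)
  have "finite K" using K(1) \<open>finite X\<close> finite_subset by blast
  have resample: "(A - W x) \<union> {x, f x} \<in> avoiding \<sigma> V" if x: "x \<in> K" and A: "A \<in> avoiding \<sigma> V" for x A
  proof -
    have xV: "x \<in> V" "f x \<noteq> x" "f x \<noteq> \<sigma> x" "f x \<noteq> \<tau> x" using x K(1) by (auto simp: X_def)
    have fV: "f x \<in> V" using f xV by auto
    let ?B = "(A - W x) \<union> {x, f x}"
    have "\<sigma> u \<notin> ?B" if u: "u \<in> ?B" for u
    proof
      assume su: "\<sigma> u \<in> ?B"
      have uV: "u \<in> V" using u A xV fV by (auto simp: avoiding_def)
      have 1: "\<sigma> x \<notin> ?B" "\<sigma> (f x) \<notin> ?B"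
        using xV fV fix_free \<sigma> by (auto simp: W_def; metis)+
      have 2: "\<tau> x \<notin> ?B" "\<tau> (f x) \<notin> ?B"
        using xV fV fix_free \<sigma> by (auto simp: W_def; metis)+
      have "u \<noteq> x" "u \<noteq> f x" using su 1 by auto
      moreover have "\<sigma> u \<noteq> x" "\<sigma> u \<noteq> f x" using u 2 \<sigma>(3)[OF uV] by auto
      ultimately have "u \<in> A" "\<sigma> u \<in> A" using u su by auto
      then show False using A by (auto simp: avoiding_def)
    qed
    then show ?thesis using A xV fV by (auto simp: avoiding_def)
  qed
  have "avoiding \<sigma> V \<inter> avoiding f V \<subseteq> {A \<in> avoiding \<sigma> V. \<forall>x\<in>K. A \<inter> W x \<noteq> {x, f x}}"
    by (auto simp: avoiding_def)
  then have "card (avoiding \<sigma> V \<inter> avoiding f V)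
      \<le> card {A \<in> avoiding \<sigma> V. \<forall>x\<in>K. A \<inter> W x \<noteq> {x, f x}}"
    by (rule card_mono[rotated]) (simp add: finite_avoiding \<open>finite V\<close>)
  also have "real \<dots> \<le> (1 - 1 / 2 ^ 6) ^ card K * real (card (avoiding \<sigma> V))"
    by (rule card_avoiding_pattern_le)
      (use card_W resample K \<open>finite K\<close> in \<open>auto simp: finite_avoiding \<open>finite V\<close> W_def\<close>)
  also have "(1 - 1 / 2 ^ 6 :: real) ^ card K = (63 / 64) powr real (card K)"
    by (simp add: powr_realpow)
  also have "\<dots> \<le> (63 / 64) powr ((real (card V) - real b) / 36)"
    using \<open>card V \<le> card X + b\<close> K(2) by (intro powr_mono') auto
  finally show ?thesis by (simp add: mult_right_mono)
qed

section \<open>Sets avoiding a single difference\<close>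

text \<open>Cutting a cycle at a point leaves a path; these are its independent sets.\<close>

definition path_sets :: "nat \<Rightarrow> nat set set" where
  "path_sets l = {A. A \<subseteq> {..<l} \<and> (\<forall>i\<in>A. Suc i \<notin> A)}"

lemma finite_path_sets: "finite (path_sets l)"
  by (rule finite_subset[of _ "Pow {..<l}"]) (auto simp: path_sets_def)

lemma card_path_sets: "card (path_sets l) = fib (l + 2)"
proof (induction l rule: fib.induct)
  case 1
  have "path_sets 0 = {{}}" by (auto simp: path_sets_def)
  then show ?case by simp
next
  case 2
  have "path_sets (Suc 0) = {{}, {0}}" by (auto simp: path_sets_def)
  then show ?case by (simp add: numeral_3_eq_3)
next
  case (3 l)
  have split: "path_sets (Suc (Suc l)) = path_sets (Suc l) \<union> insert (Suc l) ` path_sets l" (is "?L = ?R")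
  proof (intro subset_antisym subsetI)
    fix A assume A: "A \<in> ?L"
    show "A \<in> ?R"
    proof (cases "Suc l \<in> A")
      case True
      have "A - {Suc l} \<in> path_sets l"
        using A True unfolding path_sets_def by (force simp: less_Suc_eq)
      then show ?thesis using True by (intro UnI2 image_eqI[of _ _ "A - {Suc l}"]) auto
    next
      case False
      then show ?thesis using A by (force simp: path_sets_def less_Suc_eq)
    qed
  qed (fastforce simp: path_sets_def)
  have "inj_on (insert (Suc l)) (path_sets l)"
  proof (rule inj_onI)
    fix A B assume h: "A \<in> path_sets l" "B \<in> path_sets l" "insert (Suc l) A = insert (Suc l) B"
    then have "Suc l \<notin> A" "Suc l \<notin> B" by (auto simp: path_sets_def)
    with h(3) show "A = B" using insert_ident by metis
  qed
  moreover have "path_sets (Suc l) \<inter> insert (Suc l) ` path_sets l = {}"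
    by (auto simp: path_sets_def)
  ultimately show ?case
    using 3 by (simp add: split card_Un_disjoint finite_path_sets card_image)
qed

text \<open>The value is the Lucas number \<open>L\<^sub>m\<close>. If the point \<open>m - 1\<close> is not chosen, a path with \<open>m - 1\<close> points
remains; if it is, both of its neighbours drop out and a path with \<open>m - 3\<close> points remains. For
\<open>m = 2\<close> the two neighbours coincide, and nothing remains.\<close>

lemma card_avoiding_cycle:
  assumes "m \<ge> 2"
  shows "card (avoiding (\<lambda>j. Suc j mod m) {..<m}) = fib (m + 1) + fib (m - 1)"
proof -
  obtain k where k: "m = Suc k" "k \<ge> 1" using assms by (cases m) auto
  let ?S = "avoiding (\<lambda>j. Suc j mod m) {..<m}"
  have without: "{A \<in> ?S. k \<notin> A} = path_sets k"
  proof (intro subset_antisym subsetI)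
    fix A assume A: "A \<in> {A \<in> ?S. k \<notin> A}"
    have less: "i < k" if "i \<in> A" for i
      using A that k by (metis (mono_tags, lifting) avoiding_def lessThan_iff less_Suc_eq mem_Collect_eq subsetD)
    have "Suc i \<notin> A" if "i \<in> A" for i
    proof -
      have "Suc i mod m \<notin> A" using A that by (auto simp: avoiding_def)
      then show ?thesis using less[OF that] k by simp
    qed
    then show "A \<in> path_sets k" using less by (auto simp: path_sets_def)
  next
    fix A assume A: "A \<in> path_sets k"
    have "Suc i mod m \<notin> A" if "i \<in> A" for i
    proof -
      have "i < k" using A that by (auto simp: path_sets_def)
      then show ?thesis using A that k by (auto simp: path_sets_def)
    qed
    then show "A \<in> {A \<in> ?S. k \<notin> A}" using A k by (force simp: path_sets_def avoiding_def)
  qed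
  have with_top: "{A \<in> ?S. k \<in> A} = (\<lambda>B. insert k (Suc ` B)) ` path_sets (k - 2)"
  proof (intro subset_antisym subsetI)
    fix A assume A: "A \<in> {A \<in> ?S. k \<in> A}"
    have Suc: "Suc i \<notin> A" if "i \<in> A" "i < k" for i
    proof -
      have "Suc i mod m \<notin> A" using A that by (auto simp: avoiding_def)
      then show ?thesis using that k by simp
    qed
    have "0 \<notin> A" using A k by (force simp: avoiding_def)
    have le: "i \<le> k" if "i \<in> A" for i using A that k by (auto simp: avoiding_def)
    have "k - 1 \<notin> A" using Suc[of "k - 1"] k A by auto
    define B where "B = {i. Suc i \<in> A \<and> Suc i < k}"
    have "i < k - 2" if "i \<in> B" for i
    proof -
      have "Suc i \<noteq> k - 1" using that \<open>k - 1 \<notin> A\<close> by (auto simp: B_def)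
      then show ?thesis using that by (auto simp: B_def)
    qed
    then have "B \<in> path_sets (k - 2)" using Suc by (auto simp: path_sets_def B_def)
    moreover have "A = insert k (Suc ` B)"
    proof (intro subset_antisym subsetI)
      fix i assume i: "i \<in> A"
      then obtain j where "i = Suc j" using \<open>0 \<notin> A\<close> by (cases i) auto
      then show "i \<in> insert k (Suc ` B)" using le[OF i] i by (auto simp: B_def)
    qed (use A in \<open>auto simp: B_def\<close>)
    ultimately show "A \<in> (\<lambda>B. insert k (Suc ` B)) ` path_sets (k - 2)" by blast
  next
    fix A assume "A \<in> (\<lambda>B. insert k (Suc ` B)) ` path_sets (k - 2)"
    then obtain B where B: "B \<in> path_sets (k - 2)" "A = insert k (Suc ` B)" by blast
    have "Suc i mod m \<notin> A" if "i \<in> A" for i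
    proof (cases "i = k")
      case True
      then show ?thesis using B k by auto
    next
      case False
      then obtain j where j: "i = Suc j" "j \<in> B" using B \<open>i \<in> A\<close> by auto
      then have "Suc j < k - 1" using B by (auto simp: path_sets_def)
      then show ?thesis using j B k by (auto simp: path_sets_def)
    qed
    then show "A \<in> {A \<in> ?S. k \<in> A}" using B k by (force simp: path_sets_def avoiding_def)
  qed
  have "inj_on (\<lambda>B. insert k (Suc ` B)) (path_sets (k - 2))"
  proof (rule inj_onI)
    fix B C assume h: "B \<in> path_sets (k - 2)" "C \<in> path_sets (k - 2)"
      "insert k (Suc ` B) = insert k (Suc ` C)"
    then have "k \<notin> Suc ` B" "k \<notin> Suc ` C" by (auto simp: path_sets_def)
    with h(3) have "Suc ` B = Suc ` C" using insert_ident by metis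
    then show "B = C" by (simp add: inj_image_eq_iff)
  qed
  then have "card {A \<in> ?S. k \<in> A} = fib (k - 2 + 2)"
    by (simp add: with_top card_image card_path_sets del: add_2_eq_Suc')
  \<comment> \<open>For \<open>k = 1\<close> the truncated \<open>k - 2\<close> is \<open>0\<close>, which is harmless as \<open>fib 2 = fib 1\<close>.\<close>
  also have "fib (k - 2 + 2) = fib k"
  proof (cases "k = 1")
    case False
    then have "k - 2 + 2 = k" using k by simp
    then show ?thesis by simp
  qed simp
  finally have "card {A \<in> ?S. k \<in> A} = fib k" .
  moreover have "card ?S = card {A \<in> ?S. k \<notin> A} + card {A \<in> ?S. k \<in> A}"
  proof -
    have "?S = {A \<in> ?S. k \<notin> A} \<union> {A \<in> ?S. k \<in> A}" by blast
    then show ?thesis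
      using card_Un_disjoint[of "{A \<in> ?S. k \<notin> A}" "{A \<in> ?S. k \<in> A}"]
      by (simp add: finite_avoiding disjoint_iff)
  qed
  moreover have "card {A \<in> ?S. k \<notin> A} = fib (k + 2)"
    by (simp only: without card_path_sets)
  ultimately show ?thesis using k by simp
qed

text \<open>If \<open>f\<close> acts as disjoint copies of \<open>f'\<close> indexed by \<open>I\<close>, an independent set is an independent choice of
one independent set in each copy.\<close>

lemma card_avoiding_copies:
  assumes h: "bij_betw (\<lambda>(c, j). h c j) (I \<times> J) V" and "finite I"
    and f': "\<And>j. j \<in> J \<Longrightarrow> f' j \<in> J"
    and conj: "\<And>c j. c \<in> I \<Longrightarrow> j \<in> J \<Longrightarrow> f (h c j) = h c (f' j)"
  shows "card (avoiding f V) = card (avoiding f' J) ^ card I"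
proof -
  define join where "join F = (\<lambda>(c, j). h c j) ` Sigma I F" for F
  define cut where "cut A = (\<lambda>c\<in>I. {j \<in> J. h c j \<in> A})" for A
  have inj: "c = c' \<and> j = j'" if "h c j = h c' j'" "c \<in> I" "c' \<in> I" "j \<in> J" "j' \<in> J" for c c' j j'
    using h that by (auto simp: bij_betw_def inj_on_def)
  have V: "V = (\<lambda>(c, j). h c j) ` (I \<times> J)" using h by (simp add: bij_betw_def)
  have mem_join: "h c j \<in> join F \<longleftrightarrow> j \<in> F c"
    if "F \<in> (\<Pi>\<^sub>E c\<in>I. avoiding f' J)" "c \<in> I" "j \<in> J" for F c j
  proof -
    have "F c' \<subseteq> J" if "c' \<in> I" for c'
      using \<open>F \<in> _\<close> that by (auto simp: avoiding_def PiE_iff)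
    then show ?thesis using that(2,3) inj by (fastforce simp: join_def)
  qed
  have "bij_betw join (\<Pi>\<^sub>E c\<in>I. avoiding f' J) (avoiding f V)"
  proof (rule bij_betwI[where g = cut])
    show "join \<in> (\<Pi>\<^sub>E c\<in>I. avoiding f' J) \<rightarrow> avoiding f V"
    proof
      fix F assume F: "F \<in> (\<Pi>\<^sub>E c\<in>I. avoiding f' J)"
      have "join F \<subseteq> V" using F by (fastforce simp: join_def V avoiding_def PiE_iff)
      moreover have "f x \<notin> join F" if x: "x \<in> join F" for x
      proof -
        have "x \<in> V" using x \<open>join F \<subseteq> V\<close> by blast
        then obtain c j where cj: "x = h c j" "c \<in> I" "j \<in> J" by (auto simp: V)
        then have "j \<in> F c" using x mem_join[OF F] by simp
        then have "f' j \<notin> F c" using F cj by (auto simp: avoiding_def PiE_iff)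
        then show ?thesis using mem_join[OF F] cj conj f' by simp
      qed
      ultimately show "join F \<in> avoiding f V" by (auto simp: avoiding_def)
    qed
    show "cut \<in> avoiding f V \<rightarrow> (\<Pi>\<^sub>E c\<in>I. avoiding f' J)"
      by (auto simp: cut_def avoiding_def PiE_iff conj[symmetric])
    show "cut (join F) = F" if F: "F \<in> (\<Pi>\<^sub>E c\<in>I. avoiding f' J)" for F
    proof
      fix c show "cut (join F) c = F c"
      proof (cases "c \<in> I")
        case True
        then have "F c \<subseteq> J" using F by (auto simp: avoiding_def PiE_iff)
        then show ?thesis using True mem_join[OF F True] by (auto simp: cut_def)
      next
        case False
        then show ?thesis using F by (auto simp: cut_def PiE_iff extensional_def)
      qed
    qed
    show "join (cut A) = A" if A: "A \<in> avoiding f V" for A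
    proof -
      have "A \<subseteq> V" using A by (auto simp: avoiding_def)
      then show ?thesis by (force simp: join_def cut_def V)
    qed
  qed
  then have "card (avoiding f V) = card (\<Pi>\<^sub>E c\<in>I. avoiding f' J)"
    using bij_betw_same_card by metis
  then show ?thesis by (simp add: card_PiE \<open>finite I\<close>)
qed

text \<open>The orbits of the translation by \<open>d\<close> are the residue classes modulo \<open>gcd d n\<close>; \<open>c\<close> selects the orbit
and \<open>j\<close> is the position on it.\<close>

lemma bij_betw_shift_orbits:
  fixes n d :: nat
  assumes "0 < d" "d < n"
  defines "g \<equiv> gcd d n"
  shows "bij_betw (\<lambda>(c, j). (int c + int j * int d) mod int n) ({..<g} \<times> {..<n div g}) {0..<int n}"
proof -
  let ?h = "\<lambda>(c, j). (int c + int j * int d) mod int n"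
  have g: "g > 0" "g dvd n" "g dvd d" using assms by (auto simp: g_def)
  have inj: "inj_on ?h ({..<g} \<times> {..<n div g})"
  proof -
    have "c = c' \<and> j = j'" if *: "c \<in> {..<g}" "c' \<in> {..<g}" "j \<in> {..<n div g}" "j' \<in> {..<n div g}"
      and eq: "(int c + int j * int d) mod int n = (int c' + int j' * int d) mod int n"
    for c j c' j'
    proof -
    from eq have 1: "int n dvd (int c + int j * int d) - (int c' + int j' * int d)"
      by (simp add: mod_eq_dvd_iff)
    then have "int g dvd (int c + int j * int d) - (int c' + int j' * int d)"
      using g by (meson dvd_trans int_dvd_int_iff)
    moreover have "int g dvd int d" using g by simp
    ultimately have "int g dvd int c - int c'"
    proof -
      assume a: "int g dvd (int c + int j * int d) - (int c' + int j' * int d)" and b: "int g dvd int d"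
      have "int c - int c' = ((int c + int j * int d) - (int c' + int j' * int d)) - (int j - int j') * int d"
        by (simp add: algebra_simps)
      then show ?thesis using a b by (metis dvd_diff dvd_mult)
    qed
    then have c: "c = c'" using * zdvd_imp_le[of "int g" "int c - int c'"] zdvd_imp_le[of "int g" "int c' - int c"]
      by (cases c c' rule: linorder_cases) (auto simp: dvd_diff_commute)
    with 1 have "int n dvd (int j - int j') * int d" by (simp add: algebra_simps)
    moreover obtain n' d' where nd: "n = n' * g" "d = d' * g" "coprime n' d'"
    proof -
      have "coprime (n div g) (d div g)" unfolding g_def
        using assms by (metis div_gcd_coprime gcd.commute less_numeral_extra(3))
      then show ?thesis using that[of "n div g" "d div g"] g by auto
    qed
    ultimately have "int n' * int g dvd ((int j - int j') * int d') * int g"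
      by (simp add: mult.assoc)
    then have "int n' dvd (int j - int j') * int d'" using g by simp
    then have "int n' dvd int j - int j'" using nd(3) by (simp add: coprime_dvd_mult_left_iff)
    moreover have "n div g = n'" using nd g by simp
    ultimately have "j = j'" using * zdvd_imp_le[of "int n'" "int j - int j'"] zdvd_imp_le[of "int n'" "int j' - int j"]
      by (cases j j' rule: linorder_cases) (auto simp: dvd_diff_commute)
    with c show ?thesis by simp
    qed
    then show ?thesis by (auto simp: inj_on_def)
  qed
  moreover have "?h ` ({..<g} \<times> {..<n div g}) = {0..<int n}"
  proof -
    have "?h ` ({..<g} \<times> {..<n div g}) \<subseteq> {0..<int n}" using assms by auto
    moreover have "card (?h ` ({..<g} \<times> {..<n div g})) = card {0..<int n}"
      using card_image[OF inj] g by (simp add: card_cartesian_product)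
    ultimately show ?thesis by (intro card_subset_eq) simp_all
  qed
  ultimately show ?thesis by (simp add: bij_betw_def)
qed

lemma card_avoiding_shift:
  fixes n d :: nat
  assumes "0 < d" "d < n"
  defines "m \<equiv> n div gcd d n"
  shows "card (avoiding (\<lambda>x. (x + int d) mod int n) {0..<int n}) = (fib (m + 1) + fib (m - 1)) ^ gcd d n"
proof -
  have g: "gcd d n * m = n" by (simp add: m_def)
  have "gcd d n \<le> d" using assms by (simp add: gcd_le1_nat)
  then have "gcd d n < n" using assms(2) by linarith
  with g have "m \<ge> 2" by (cases "m = 0 \<or> m = 1") auto
  have step: "((int c + int j * int d) mod int n + int d) mod int n
      = (int c + int (Suc j mod m) * int d) mod int n" for c j
  proof -
    have "int n dvd int m * int d"
    proof -
      obtain d' where "d = gcd d n * d'" by (meson dvdE gcd_dvd1)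
      then have "m * d = n * d'" using g by (metis mult.assoc mult.commute)
      then show ?thesis by (metis dvd_triv_left int_dvd_int_iff of_nat_mult)
    qed
    moreover have "int (Suc j) * int d = int (Suc j mod m) * int d + int (Suc j div m) * (int m * int d)"
      by (metis (no_types, opaque_lifting) add.commute distrib_right mod_mult_div_eq mult.assoc mult.commute of_nat_add of_nat_mult)
    ultimately have "(int c + int (Suc j) * int d) mod int n = (int c + int (Suc j mod m) * int d) mod int n"
      by (simp add: mod_eq_dvd_iff del: of_nat_Suc)
    moreover have "((int c + int j * int d) mod int n + int d) mod int n = (int c + int (Suc j) * int d) mod int n"
      by (simp add: mod_simps algebra_simps)
    ultimately show ?thesis by simp
  qed
  have "card (avoiding (\<lambda>x. (x + int d) mod int n) {0..<int n})
      = card (avoiding (\<lambda>j. Suc j mod m) {..<m}) ^ card {..<gcd d n}"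
    by (rule card_avoiding_copies[OF bij_betw_shift_orbits[OF assms(1,2), folded m_def]])
      (use step \<open>m \<ge> 2\<close> in auto)
  then show ?thesis using card_avoiding_cycle[OF \<open>m \<ge> 2\<close>] by simp
qed

section \<open>Missing sums and differences modulo n\<close>

definition no_diff :: "nat \<Rightarrow> nat \<Rightarrow> int set set" where
  "no_diff n d = avoiding (\<lambda>x. (x + int d) mod int n) {0..<int n}"

definition no_sum :: "nat \<Rightarrow> nat \<Rightarrow> int set set" where
  "no_sum n s = avoiding (\<lambda>x. (int s - x) mod int n) {0..<int n}"

lemma finite_no_diff: "finite (no_diff n d)"
  by (simp add: no_diff_def finite_avoiding)

lemma mem_sumset_integer_mod_group:
  assumes "A \<subseteq> {0..<int n}" "s < n"
  shows "int s \<in> sumset (integer_mod_group n) A \<longleftrightarrow> A \<notin> no_sum n s"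
proof -
  have key: "int s = (a + b) mod int n \<longleftrightarrow> (int s - a) mod int n = b" if "b \<in> {0..<int n}" for a b
  proof -
    have "int s = (a + b) mod int n \<longleftrightarrow> int n dvd int s - (a + b)"
      using assms(2) by (metis mod_eq_dvd_iff mod_pos_pos_trivial of_nat_0_le_iff of_nat_less_iff)
    also have "\<dots> \<longleftrightarrow> int n dvd (int s - a) - b" by (simp add: algebra_simps)
    also have "\<dots> \<longleftrightarrow> (int s - a) mod int n = b"
      using that by (metis atLeastLessThan_iff mod_eq_dvd_iff mod_pos_pos_trivial)
    finally show ?thesis .
  qed
  have "(\<exists>a\<in>A. \<exists>b\<in>A. int s = (a + b) mod int n) \<longleftrightarrow> (\<exists>a\<in>A. \<exists>b\<in>A. (int s - a) mod int n = b)"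
    by (intro bex_cong refl key) (use assms(1) in blast)
  then show ?thesis using assms(1)
    by (simp add: sumset_def no_sum_def avoiding_def) blast
qed

lemma mem_diffset_integer_mod_group:
  assumes "A \<subseteq> {0..<int n}" "d < n"
  shows "int d \<in> diffset (integer_mod_group n) A \<longleftrightarrow> A \<notin> no_diff n d"
proof -
  have carrier: "carrier (integer_mod_group n) = {0..<int n}"
    using assms(2) by (simp add: carrier_integer_mod_group)
  have inv: "(a + (inv\<^bsub>integer_mod_group n\<^esub> b)) mod int n = (a - b) mod int n" if "b \<in> A" for a b
    using that assms(1) by (subst inv_integer_mod_group) (auto simp: carrier mod_simps)
  have key: "int d = (a - b) mod int n \<longleftrightarrow> (b + int d) mod int n = a" if "a \<in> {0..<int n}" for a b
  proof -
    have "int d = (a - b) mod int n \<longleftrightarrow> int n dvd (a - b) - int d"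
      using assms(2) by (metis mod_eq_dvd_iff mod_pos_pos_trivial of_nat_0_le_iff of_nat_less_iff)
    also have "\<dots> \<longleftrightarrow> int n dvd a - (b + int d)" by (simp add: algebra_simps)
    also have "\<dots> \<longleftrightarrow> (b + int d) mod int n = a"
      using that by (metis atLeastLessThan_iff mod_eq_dvd_iff mod_pos_pos_trivial)
    finally show ?thesis .
  qed
  have "(\<exists>b\<in>A. \<exists>a\<in>A. int d = (a - b) mod int n) \<longleftrightarrow> (\<exists>b\<in>A. \<exists>a\<in>A. (b + int d) mod int n = a)"
    by (intro bex_cong refl key) (use assms(1) in blast)
  moreover have "int d \<in> diffset (integer_mod_group n) A \<longleftrightarrow> (\<exists>b\<in>A. \<exists>a\<in>A. int d = (a - b) mod int n)"
    unfolding diffset_def mult_integer_mod_group mem_Collect_eq using inv by metis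
  ultimately show ?thesis using assms(1)
    by (simp add: no_diff_def avoiding_def)
qed

lemma no_diff_uminus:
  assumes "0 < d" "d < n"
  shows "no_diff n (n - d) = no_diff n d"
proof -
  have *: "A \<in> no_diff n (n - e)" if A: "A \<in> no_diff n e" and e: "0 < e" "e < n" for A e
  proof -
    have AV: "A \<subseteq> {0..<int n}" using A by (auto simp: no_diff_def avoiding_def)
    have "(x + int (n - e)) mod int n \<notin> A" if x: "x \<in> A" for x
    proof
      assume a: "(x + int (n - e)) mod int n \<in> A"
      have "((x + int (n - e)) mod int n + int e) mod int n = (x + int n) mod int n"
        using e by (simp add: mod_simps of_nat_diff)
      also have "\<dots> = x" using AV x by auto
      finally show False using A a x by (auto simp: no_diff_def avoiding_def)
    qed
    then show ?thesis using AV by (auto simp: no_diff_def avoiding_def)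
  qed
  have "n - (n - d) = d" using assms by simp
  then show ?thesis using *[of _ d] *[of _ "n - d"] assms by force
qed

text \<open>An MSTD set is nonempty, so its differences include \<open>0\<close>; having fewer differences than sums, it misses
some \<open>d \<noteq> 0\<close>, and by symmetry it also misses \<open>n - d\<close>.\<close>

lemma MSTD_lacks_small_difference:
  assumes A: "A \<in> MSTD (integer_mod_group n)" and "n > 0"
  shows "\<exists>d\<in>{1..n div 2}. A \<in> no_diff n d"
proof -
  have AV: "A \<subseteq> {0..<int n}"
    and less: "card (diffset (integer_mod_group n) A) < card (sumset (integer_mod_group n) A)"
    using A \<open>n > 0\<close> by (auto simp: MSTD_def carrier_integer_mod_group)
  have "sumset (integer_mod_group n) A \<subseteq> {0..<int n}"
    using \<open>n > 0\<close> by (auto simp: sumset_def)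
  then have "card (diffset (integer_mod_group n) A) < card {0..<int n}"
    using less card_mono[of "{0..<int n}" "sumset (integer_mod_group n) A"] by simp
  moreover have "finite (diffset (integer_mod_group n) A)"
    unfolding diffset_def using AV by (intro finite_image_set2) (simp_all add: finite_subset)
  ultimately have "\<not> {0..<int n} \<subseteq> diffset (integer_mod_group n) A"
    using card_mono by (metis linorder_not_less)
  then obtain z where "z \<in> {0..<int n}" "z \<notin> diffset (integer_mod_group n) A" by blast
  then obtain d where d: "d < n" "int d \<notin> diffset (integer_mod_group n) A"
    by (metis atLeastLessThan_iff nonneg_int_cases of_nat_less_iff)
  then have dA: "A \<in> no_diff n d" using mem_diffset_integer_mod_group[OF AV] by blast
  have "A \<noteq> {}" using less by (auto simp: sumset_def)
  have "d \<noteq> 0"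
  proof
    assume "d = 0"
    then have "x mod int n \<notin> A" if "x \<in> A" for x using dA that by (auto simp: no_diff_def avoiding_def)
    moreover have "x mod int n = x" if "x \<in> A" for x using AV that by auto
    ultimately show False using \<open>A \<noteq> {}\<close> by auto
  qed
  show ?thesis
  proof (cases "d \<le> n div 2")
    case True
    then show ?thesis using dA \<open>d \<noteq> 0\<close> by (intro bexI[of _ d]) auto
  next
    case False
    then show ?thesis using dA \<open>d \<noteq> 0\<close> no_diff_uminus[of d n] d(1)
      by (intro bexI[of _ "n - d"]) auto
  qed
qed

lemma card_MSTD_le:
  assumes "n > 0"
  shows "card (MSTD (integer_mod_group n)) \<le> (\<Sum>d=1..n div 2. card (no_diff n d))"
proof -
  have "MSTD (integer_mod_group n) \<subseteq> (\<Union>d\<in>{1..n div 2}. no_diff n d)"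
    using MSTD_lacks_small_difference assms by blast
  then have "card (MSTD (integer_mod_group n)) \<le> card (\<Union>d\<in>{1..n div 2}. no_diff n d)"
    by (rule card_mono[rotated]) (simp add: finite_no_diff)
  also have "\<dots> \<le> (\<Sum>d=1..n div 2. card (no_diff n d))"
    by (rule card_UN_le) simp
  finally show ?thesis .
qed

text \<open>All \<open>n\<close> sums are present against at most \<open>n - 1\<close> differences.\<close>

lemma all_sums_imp_MSTD:
  assumes "0 < d" "d < n" and A: "A \<in> no_diff n d" and sums: "\<And>s. s < n \<Longrightarrow> A \<notin> no_sum n s"
  shows "A \<in> MSTD (integer_mod_group n)"
proof -
  have AV: "A \<subseteq> {0..<int n}" using A by (auto simp: no_diff_def avoiding_def)
  have carrier: "carrier (integer_mod_group n) = {0..<int n}"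
    using assms by (simp add: carrier_integer_mod_group)
  have "diffset (integer_mod_group n) A \<subseteq> {0..<int n} - {int d}"
    using mem_diffset_integer_mod_group[OF AV \<open>d < n\<close>] A assms(1,2) by (auto simp: diffset_def)
  then have "card (diffset (integer_mod_group n) A) \<le> card ({0..<int n} - {int d})"
    by (rule card_mono[rotated]) simp
  also have "\<dots> < card {0..<int n}" using assms by (intro card_Diff1_less) auto
  also have "{0..<int n} \<subseteq> sumset (integer_mod_group n) A"
    using mem_sumset_integer_mod_group[OF AV] sums
    by (metis atLeastLessThan_iff nonneg_int_cases of_nat_less_iff subsetI)
  then have "card {0..<int n} \<le> card (sumset (integer_mod_group n) A)"
    by (rule card_mono[rotated])
      (rule finite_subset[of _ "{0..<int n}"], use assms in \<open>auto simp: sumset_def\<close>)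
  finally show ?thesis using AV by (auto simp: MSTD_def carrier finite_subset)
qed

lemma card_double_residue_le: "card {x \<in> {0..<int n}. int n dvd 2 * x - t} \<le> 2"
proof (cases "n = 0")
  case False
  have "{x \<in> {0..<int n}. int n dvd 2 * x - t} \<subseteq> {t mod int n div 2, (t mod int n + int n) div 2}"
  proof
    fix x assume x: "x \<in> {x \<in> {0..<int n}. int n dvd 2 * x - t}"
    then have "(2 * x) mod int n = (t mod int n) mod int n" by (simp add: mod_eq_dvd_iff)
    then have "int n dvd 2 * x - t mod int n" by (simp only: mod_eq_dvd_iff)
    then obtain k where k: "2 * x - t mod int n = int n * k" by (auto elim: dvdE)
    have "0 \<le> t mod int n" "t mod int n < int n" using False by auto
    moreover have "0 \<le> x" "x < int n" using x by auto
    ultimately have "int n * (- 1) < int n * k" "int n * k < int n * 2" using k by linarith+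
    moreover have "0 < int n" using False by simp
    ultimately have "- 1 < k" "k < 2" by (simp_all only: mult_less_cancel_left_pos)
    then have "k = 0 \<or> k = 1" by auto
    with k show "x \<in> {t mod int n div 2, (t mod int n + int n) div 2}" by auto
  qed
  then have "card {x \<in> {0..<int n}. int n dvd 2 * x - t} \<le> card {t mod int n div 2, (t mod int n + int n) div 2}"
    by (rule card_mono[rotated]) simp
  also have "\<dots> \<le> 2" by (simp add: card_insert_if)
  finally show ?thesis .
qed simp

text \<open>Both parts are instances of \<open>card_avoiding_two_le\<close> with \<open>\<sigma>\<close> the translation by \<open>d\<close>. For a second
translation no point is exceptional. For the reflection at \<open>s\<close> the exceptional points solve
\<open>2x = s\<close> or \<open>2x = s \<plusminus> d\<close> modulo \<open>n\<close>, and each of these three equations has at most two solutions: this is the \<open>6\<close> in the exponent.\<close>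

lemma
  fixes n d :: nat
  assumes d: "0 < d" "d < n"
  shows card_no_diff_two_le: "\<lbrakk>0 < e; e < n; e \<noteq> d; e \<noteq> n - d\<rbrakk> \<Longrightarrow>
      real (card (no_diff n d \<inter> no_diff n e)) \<le> (63 / 64) powr ((real n - 6) / 36) * real (card (no_diff n d))"
    and card_no_diff_no_sum_le:
      "real (card (no_diff n d \<inter> no_sum n s)) \<le> (63 / 64) powr ((real n - 6) / 36) * real (card (no_diff n d))"
proof -
  let ?V = "{0..<int n}"
  define \<sigma> where "\<sigma> x = (x + int d) mod int n" for x
  define \<tau> where "\<tau> x = (x - int d) mod int n" for x
  have eq_iff: "a mod int n = b mod int n \<longleftrightarrow> int n dvd a - b" for a b by (rule mod_eq_dvd_iff)
  have red: "x mod int n = x" if "x \<in> ?V" for x using that by auto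
  have *: "real (card (avoiding \<sigma> ?V \<inter> avoiding f ?V))
      \<le> (63 / 64) powr ((real n - 6) / 36) * real (card (avoiding \<sigma> ?V))"
    if f: "\<And>x. x \<in> ?V \<Longrightarrow> f x \<in> ?V" "\<And>x. x \<in> ?V \<Longrightarrow> g (f x) = x"
      and few: "card {x \<in> ?V. f x = x \<or> f x = \<sigma> x \<or> f x = \<tau> x} \<le> 6" for f g
  proof -
    have "\<sigma> x \<noteq> x" if "x \<in> ?V" for x
    proof
      assume "\<sigma> x = x"
      then have "(x + int d) mod int n = x mod int n" using red[OF that] by (simp add: \<sigma>_def)
      then have "n dvd d" by (simp add: eq_iff)
      then show False using d by (auto dest: dvd_imp_le)
    qed
    moreover have "\<tau> (\<sigma> x) = x" "\<sigma> (\<tau> x) = x" if "x \<in> ?V" for x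
      using red[OF that] by (simp_all add: \<sigma>_def \<tau>_def mod_simps)
    moreover have "\<sigma> x \<in> ?V" "\<tau> x \<in> ?V" for x using d by (auto simp: \<sigma>_def \<tau>_def)
    ultimately show ?thesis
      using card_avoiding_two_le[of ?V \<sigma> \<tau> f g 6] f few by auto
  qed
  have \<sigma>: "avoiding \<sigma> ?V = no_diff n d" by (simp add: no_diff_def \<sigma>_def[abs_def])
  show "real (card (no_diff n d \<inter> no_diff n e))
      \<le> (63 / 64) powr ((real n - 6) / 36) * real (card (no_diff n d))"
    if e: "0 < e" "e < n" "e \<noteq> d" "e \<noteq> n - d"
  proof -
    let ?f = "\<lambda>x. (x + int e) mod int n" and ?g = "\<lambda>x. (x - int e) mod int n"
    have "?f x \<noteq> x \<and> ?f x \<noteq> \<sigma> x \<and> ?f x \<noteq> \<tau> x" if x: "x \<in> ?V" for x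
    proof (intro conjI notI)
      assume "?f x = x"
      then have "?f x = x mod int n" using red[OF x] by simp
      then have "n dvd e" by (simp add: eq_iff)
      then show False using e by (auto dest: dvd_imp_le)
    next
      assume "?f x = \<sigma> x"
      then have "int n dvd int e - int d" by (simp add: eq_iff \<sigma>_def)
      then show False using e d zdvd_imp_le[of "int n" "int e - int d"] zdvd_imp_le[of "int n" "int d - int e"]
        by (cases e d rule: linorder_cases) (auto simp: dvd_diff_commute)
    next
      assume "?f x = \<tau> x"
      then have "int n dvd (int e + int d)" by (simp add: eq_iff \<tau>_def)
      then have "int n dvd (int e + int d) - int n" by (simp add: dvd_diff)
      then show False
        using e d zdvd_imp_le[of "int n" "int e + int d - int n"] zdvd_imp_le[of "int n" "int n - (int e + int d)"]
        by (cases "e + d" n rule: linorder_cases) (auto simp: dvd_diff_commute)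
    qed
    then have "{x \<in> ?V. ?f x = x \<or> ?f x = \<sigma> x \<or> ?f x = \<tau> x} = {}" by blast
    then have "card {x \<in> ?V. ?f x = x \<or> ?f x = \<sigma> x \<or> ?f x = \<tau> x} \<le> 6" by (simp only: card.empty)
    moreover have "?g (?f x) = x" if "x \<in> ?V" for x using red[OF that] by (simp add: mod_simps)
    moreover have "?f x \<in> ?V" for x using d by auto
    ultimately show ?thesis using *[of ?f ?g] by (simp add: \<sigma> no_diff_def)
  qed
  show "real (card (no_diff n d \<inter> no_sum n s))
      \<le> (63 / 64) powr ((real n - 6) / 36) * real (card (no_diff n d))"
  proof -
    let ?f = "\<lambda>x. (int s - x) mod int n"
    let ?R = "\<lambda>t. {x \<in> ?V. int n dvd 2 * x - t}"
    have "{x \<in> ?V. ?f x = x \<or> ?f x = \<sigma> x \<or> ?f x = \<tau> x}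
        \<subseteq> ?R (int s) \<union> (?R (int s - int d) \<union> ?R (int s + int d))"
    proof
      fix x assume "x \<in> {x \<in> ?V. ?f x = x \<or> ?f x = \<sigma> x \<or> ?f x = \<tau> x}"
      then have x: "x \<in> ?V" and c: "?f x = x mod int n \<or> ?f x = \<sigma> x \<or> ?f x = \<tau> x" by auto
      from c have "int n dvd (int s - x) - x \<or> int n dvd (int s - x) - (x + int d)
          \<or> int n dvd (int s - x) - (x - int d)"
        by (simp only: eq_iff \<sigma>_def \<tau>_def)
      then have "int n dvd 2 * x - int s \<or> int n dvd 2 * x - (int s - int d) \<or> int n dvd 2 * x - (int s + int d)"
        by (subst (1 2 3) dvd_diff_commute) (simp add: algebra_simps)
      with x show "x \<in> ?R (int s) \<union> (?R (int s - int d) \<union> ?R (int s + int d))" by blast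
    qed
    then have "card {x \<in> ?V. ?f x = x \<or> ?f x = \<sigma> x \<or> ?f x = \<tau> x}
        \<le> card (?R (int s) \<union> (?R (int s - int d) \<union> ?R (int s + int d)))"
      by (rule card_mono[rotated]) (rule finite_subset[of _ ?V], auto)
    also have "\<dots> \<le> card (?R (int s)) + (card (?R (int s - int d)) + card (?R (int s + int d)))"
      by (intro order.trans[OF card_Un_le] add_mono order.refl card_Un_le)
    also have "\<dots> \<le> 2 + (2 + 2)" by (intro add_mono card_double_residue_le)
    finally have "card {x \<in> ?V. ?f x = x \<or> ?f x = \<sigma> x \<or> ?f x = \<tau> x} \<le> 6" by simp
    moreover have "?f (?f x) = x" if "x \<in> ?V" for x using red[OF that] by (simp add: mod_simps)
    moreover have "?f x \<in> ?V" for x using d by auto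
    ultimately show ?thesis using *[of ?f ?f] by (simp add: \<sigma> no_sum_def)
  qed
qed

section \<open>MSTD sets and a single missing difference\<close>

lemma card_Diff_Union_ge:
  assumes "finite X" "finite \<B>"
  shows "real (card (X - \<Union>\<B>)) \<ge> real (card X) - (\<Sum>B\<in>\<B>. real (card (X \<inter> B)))"
proof -
  have "card (\<Union>B\<in>\<B>. X \<inter> B) \<le> (\<Sum>B\<in>\<B>. card (X \<inter> B))"
    by (rule card_UN_le) (rule assms)
  moreover have "card X \<le> card (X - \<Union>\<B>) + card (\<Union>B\<in>\<B>. X \<inter> B)"
  proof -
    have "X = (X - \<Union>\<B>) \<union> (\<Union>B\<in>\<B>. X \<inter> B)" by blast
    then show ?thesis using card_Un_le by metis
  qed
  ultimately have "card X \<le> card (X - \<Union>\<B>) + (\<Sum>B\<in>\<B>. card (X \<inter> B))" by linarith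
  then have "real (card X) \<le> real (card (X - \<Union>\<B>) + (\<Sum>B\<in>\<B>. card (X \<inter> B)))"
    by (rule of_nat_mono)
  then show ?thesis by simp
qed

text \<open>Remove from the sets missing \<open>d\<close> all those that miss a sum or a difference other than \<open>\<plusminus>d\<close>. What is
left consists of MSTD sets and is disjoint for different \<open>d \<le> n/2\<close>, while each of the at most \<open>2n\<close>
removed families is exponentially small relative to the whole.\<close>

lemma card_MSTD_ge:
  assumes "n > 0" and H: "H \<subseteq> {d. 0 < d \<and> 2 * d \<le> n}"
  shows "real (card (MSTD (integer_mod_group n)))
    \<ge> (1 - 2 * real n * (63 / 64) powr ((real n - 6) / 36)) * (\<Sum>d\<in>H. real (card (no_diff n d)))"
proof -
  define \<B> where "\<B> d = no_diff n ` ({0<..<n} - {d, n - d}) \<union> no_sum n ` {..<n}" for d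
  define E where "E d = no_diff n d - \<Union>(\<B> d)" for d
  let ?q = "(63 / 64 :: real) powr ((real n - 6) / 36)"
  have dn: "0 < d" "d < n" if "d \<in> H" for d using H that by auto
  have "H \<subseteq> {..n}" using H by auto
  then have "finite H" using finite_subset by blast
  have E: "real (card (E d)) \<ge> (1 - 2 * real n * ?q) * real (card (no_diff n d))" if "d \<in> H" for d
  proof -
    have "card (\<B> d) \<le> card ({0<..<n} - {d, n - d}) + card {..<n}"
      unfolding \<B>_def by (intro order.trans[OF card_Un_le] add_mono card_image_le) auto
    also have "card ({0<..<n} - {d, n - d}) \<le> card {0<..<n}" by (rule card_mono) auto
    finally have card_B: "card (\<B> d) \<le> 2 * n" by simp
    have "real (card (no_diff n d \<inter> B)) \<le> ?q * real (card (no_diff n d))" if B: "B \<in> \<B> d" for B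
    proof -
      from B have "(\<exists>e. 0 < e \<and> e < n \<and> e \<noteq> d \<and> e \<noteq> n - d \<and> B = no_diff n e) \<or> (\<exists>s. B = no_sum n s)"
        by (auto simp: \<B>_def)
      then consider e where "B = no_diff n e" "0 < e" "e < n" "e \<noteq> d" "e \<noteq> n - d"
        | s where "B = no_sum n s" by blast
      then show ?thesis
        using card_no_diff_two_le[OF dn[OF \<open>d \<in> H\<close>]] card_no_diff_no_sum_le[OF dn[OF \<open>d \<in> H\<close>]]
        by cases simp_all
    qed
    then have "(\<Sum>B\<in>\<B> d. real (card (no_diff n d \<inter> B))) \<le> (\<Sum>B\<in>\<B> d. ?q * real (card (no_diff n d)))"
      by (rule sum_mono)
    also have "\<dots> = real (card (\<B> d)) * (?q * real (card (no_diff n d)))" by simp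
    also have "\<dots> \<le> (2 * real n) * (?q * real (card (no_diff n d)))"
      using of_nat_mono[OF card_B, where 'a = real] by (intro mult_right_mono) auto
    finally show ?thesis
      using card_Diff_Union_ge[of "no_diff n d" "\<B> d"]
      by (simp add: E_def \<B>_def finite_no_diff algebra_simps)
  qed
  have "\<forall>d\<in>H. \<forall>e\<in>H. d \<noteq> e \<longrightarrow> E d \<inter> E e = {}"
  proof (intro ballI impI)
    fix d e assume de: "d \<in> H" "e \<in> H" "d \<noteq> e"
    then have "2 * d \<le> n" "2 * e \<le> n" using H by auto
    then have "e \<noteq> n - d" using \<open>d \<noteq> e\<close> by auto
    then have "no_diff n e \<in> \<B> d" using de dn by (auto simp: \<B>_def)
    then show "E d \<inter> E e = {}" by (auto simp: E_def)
  qed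
  moreover have "\<forall>d\<in>H. finite (E d)" by (simp add: E_def finite_no_diff)
  ultimately have "(\<Sum>d\<in>H. card (E d)) = card (\<Union>d\<in>H. E d)"
    using card_UN_disjoint[OF \<open>finite H\<close>] by metis
  moreover have "(\<Union>d\<in>H. E d) \<subseteq> MSTD (integer_mod_group n)"
  proof
    fix A assume "A \<in> (\<Union>d\<in>H. E d)"
    then obtain d where d: "d \<in> H" "A \<in> E d" by blast
    then have "A \<notin> no_sum n s" if "s < n" for s using that by (auto simp: E_def \<B>_def)
    then show "A \<in> MSTD (integer_mod_group n)"
      using all_sums_imp_MSTD[of d n A] dn[OF d(1)] d(2) by (auto simp: E_def)
  qed
  then have "card (\<Union>d\<in>H. E d) \<le> card (MSTD (integer_mod_group n))"
    by (rule card_mono[rotated])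
      (rule finite_subset[of _ "Pow {0..<int n}"],
        use \<open>n > 0\<close> in \<open>auto simp: MSTD_def carrier_integer_mod_group\<close>)
  ultimately have "(\<Sum>d\<in>H. card (E d)) \<le> card (MSTD (integer_mod_group n))" by simp
  then have "(\<Sum>d\<in>H. real (card (E d))) \<le> real (card (MSTD (integer_mod_group n)))"
    by (metis of_nat_mono of_nat_sum)
  moreover have "(\<Sum>d\<in>H. (1 - 2 * real n * ?q) * real (card (no_diff n d))) \<le> (\<Sum>d\<in>H. real (card (E d)))"
    by (rule sum_mono) (rule E)
  ultimately show ?thesis by (simp add: sum_distrib_left)
qed

section \<open>Asymptotics\<close>

definition \<phi> :: real where "\<phi> = (1 + sqrt 5) / 2"
definition \<psi> :: real where "\<psi> = (1 - sqrt 5) / 2"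

lemma golden_ratio_gt_1: "\<phi> > 1"
  using real_less_rsqrt[of 1 5] by (simp add: \<phi>_def)

lemma golden_ratio_conj: "\<psi> = - (1 / \<phi>)"
proof -
  have "\<psi> * \<phi> = - 1" by (simp add: \<phi>_def \<psi>_def field_simps)
  then show ?thesis using golden_ratio_gt_1 by (simp add: field_simps)
qed

lemma lucas_closed_form:
  assumes "m \<ge> 1"
  shows "real (fib (m + 1) + fib (m - 1)) = \<phi> ^ m + \<psi> ^ m"
proof -
  obtain k where k: "m = Suc k" using assms by (cases m) auto
  have "\<phi>\<^sup>2 + 1 = sqrt 5 * \<phi>" "\<psi>\<^sup>2 + 1 = - (sqrt 5 * \<psi>)"
    by (simp_all add: \<phi>_def \<psi>_def power2_eq_square field_simps)
  then have *: "\<phi> ^ k * (\<phi>\<^sup>2 + 1) = \<phi> ^ k * (sqrt 5 * \<phi>)" "\<psi> ^ k * (\<psi>\<^sup>2 + 1) = - (\<psi> ^ k * (sqrt 5 * \<psi>))"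
    by simp_all
  have "real (fib (m + 1) + fib (m - 1)) = (\<phi> ^ k * (\<phi>\<^sup>2 + 1) - \<psi> ^ k * (\<psi>\<^sup>2 + 1)) / sqrt 5"
    by (simp add: fib_closed_form[folded \<phi>_def \<psi>_def] k power2_eq_square field_simps del: fib.simps)
  also have "\<dots> = \<phi> ^ m + \<psi> ^ m"
    by (simp only: *) (simp add: k field_simps)
  finally show ?thesis .
qed

text \<open>Here \<open>n div gcd d n\<close> is the order of \<open>d\<close> in \<open>\<int>/n\<int>\<close>.\<close>

lemma shift_order:
  fixes n d :: nat
  assumes "0 < d" "d < n"
  shows "gcd d n * (n div gcd d n) = n" and "n div gcd d n \<ge> 2"
    and "2 * d < n \<Longrightarrow> n div gcd d n \<ge> 3"
proof -
  show g: "gcd d n * (n div gcd d n) = n" by simp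
  have "gcd d n \<le> d" using assms by (simp add: gcd_le1_nat)
  then have "gcd d n < n" using assms(2) by linarith
  then have "n div gcd d n \<noteq> 0" "n div gcd d n \<noteq> 1" using g
    by (metis mult_0_right not_less0, metis mult.right_neutral less_irrefl)
  then show "n div gcd d n \<ge> 2" by linarith
  assume "2 * d < n"
  then have "gcd d n * 2 < n" using \<open>gcd d n \<le> d\<close> by linarith
  with g have "n div gcd d n \<noteq> 2" by (metis less_irrefl)
  with \<open>n div gcd d n \<ge> 2\<close> show "n div gcd d n \<ge> 3" by linarith
qed

lemma card_no_diff:
  assumes "0 < d" "d < n"
  shows "card (no_diff n d) = (fib (n div gcd d n + 1) + fib (n div gcd d n - 1)) ^ gcd d n"
  using card_avoiding_shift[OF assms] by (simp add: no_diff_def)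

text \<open>The order \<open>m\<close> of \<open>d\<close> is odd, so \<open>\<psi>\<^sup>m < 0\<close> and \<open>L\<^sub>m < \<phi>\<^sup>m\<close>.\<close>

lemma card_no_diff_odd_le:
  assumes "odd n" "0 < d" "d < n"
  shows "real (card (no_diff n d)) \<le> \<phi> ^ n"
proof -
  define m where "m = n div gcd d n"
  have m: "gcd d n * m = n" "m \<ge> 2" using shift_order[OF assms(2,3)] by (simp_all add: m_def)
  then have "odd m" using assms(1) by (metis dvd_trans dvd_triv_right)
  have "\<psi> \<le> 0" using golden_ratio_gt_1 by (simp add: golden_ratio_conj)
  with \<open>odd m\<close> have "\<psi> ^ m \<le> 0" by (simp add: power_le_zero_eq odd_pos)
  then have "real (fib (m + 1) + fib (m - 1)) \<le> \<phi> ^ m"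
    using lucas_closed_form[of m] m by linarith
  then have "real (fib (m + 1) + fib (m - 1)) ^ gcd d n \<le> (\<phi> ^ m) ^ gcd d n"
    by (intro power_mono) auto
  also have "\<dots> = \<phi> ^ n" by (metis m(1) mult.commute power_mult)
  finally show ?thesis using card_no_diff[OF assms(2,3)] by (simp add: m_def)
qed

text \<open>For \<open>d\<close> of odd order \<open>m\<close>, \<open>L\<^sub>m = \<phi>\<^sup>m (1 - \<phi> powr (-2m))\<close>, and Bernoulli's inequality handles
the power \<open>gcd d n \<le> n\<close> of the second factor.\<close>

lemma card_no_diff_odd_ge:
  assumes "odd n" "0 < d" "d < n" and M: "M \<le> real (n div gcd d n)"
  shows "real (card (no_diff n d)) \<ge> (1 - real n * \<phi> powr (- 2 * M)) * \<phi> ^ n"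
proof -
  define m where "m = n div gcd d n"
  have m: "gcd d n * m = n" "m \<ge> 2" using shift_order[OF assms(2,3)] by (simp_all add: m_def)
  then have "odd m" using assms(1) by (metis dvd_trans dvd_triv_right)
  have "\<phi> > 0" using golden_ratio_gt_1 by linarith
  have "\<psi> ^ m = - (1 / \<phi> ^ m)"
    by (simp only: golden_ratio_conj power_minus_odd[OF \<open>odd m\<close>] power_one_over)
  also have "\<dots> = \<phi> ^ m * (- (\<phi> powr (- 2 * real m)))"
  proof -
    have "\<phi> powr (- 2 * real m) = \<phi> powr (- real m) * \<phi> powr (- real m)"
      by (simp add: powr_add[symmetric])
    moreover have "\<phi> powr (- real m) = 1 / \<phi> ^ m"
      using \<open>\<phi> > 0\<close> by (simp add: powr_minus powr_realpow divide_inverse)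
    ultimately show ?thesis using \<open>\<phi> > 0\<close> by simp
  qed
  finally have L: "real (fib (m + 1) + fib (m - 1)) = \<phi> ^ m * (1 + - (\<phi> powr (- 2 * real m)))"
    using lucas_closed_form[of m] m by (simp add: algebra_simps)
  have small: "\<phi> powr (- 2 * real m) \<le> \<phi> powr (- 2 * M)" "\<phi> powr (- 2 * real m) \<le> \<phi> powr 0"
    using golden_ratio_gt_1 M by (intro powr_mono; simp add: m_def)+
  have "gcd d n \<le> n" using assms by (simp add: gcd_le2_nat)
  then have "real (gcd d n) * \<phi> powr (- 2 * real m) \<le> real n * \<phi> powr (- 2 * M)"
    using small(1) by (intro mult_mono) auto
  then have "1 - real n * \<phi> powr (- 2 * M) \<le> 1 + real (gcd d n) * - (\<phi> powr (- 2 * real m))"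
    by simp
  also have "\<dots> \<le> (1 + - (\<phi> powr (- 2 * real m))) ^ gcd d n"
    using small(2) \<open>\<phi> > 0\<close> by (intro Bernoulli_inequality) simp
  finally have "(1 - real n * \<phi> powr (- 2 * M)) * \<phi> ^ n
      \<le> (1 + - (\<phi> powr (- 2 * real m))) ^ gcd d n * \<phi> ^ n"
    using \<open>\<phi> > 0\<close> by (intro mult_right_mono) auto
  also have "\<dots> = (1 + - (\<phi> powr (- 2 * real m))) ^ gcd d n * (\<phi> ^ m) ^ gcd d n"
    by (metis m(1) mult.commute power_mult)
  also have "\<dots> = real (fib (m + 1) + fib (m - 1)) ^ gcd d n"
    by (simp only: L power_mult_distrib mult.commute)
  also have "\<dots> = real (card (no_diff n d))" using card_no_diff[OF assms(2,3)] by (simp add: m_def)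
  finally show ?thesis .
qed

text \<open>An element \<open>d\<close> of order \<open>m\<close> is a multiple \<open>a \<cdot> (n/m)\<close> with \<open>a < m\<close>, so it is determined by the pair
\<open>(m, a)\<close>, for which there are at most \<open>k\<^sup>2\<close> possibilities.\<close>

lemma card_small_order_le: "card {d \<in> {0<..<n}. n div gcd d n \<le> k} \<le> k ^ 2"
proof -
  let ?h = "\<lambda>d. (n div gcd d n, d div gcd d n)"
  have "inj_on ?h {d \<in> {0<..<n}. n div gcd d n \<le> k}"
  proof (rule inj_onI)
    fix d e assume de: "d \<in> {d \<in> {0<..<n}. n div gcd d n \<le> k}" "e \<in> {d \<in> {0<..<n}. n div gcd d n \<le> k}"
      and h: "?h d = ?h e"
    have "gcd d n * (n div gcd d n) = n" "gcd e n * (n div gcd e n) = n" by simp_all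
    then have "gcd d n * (n div gcd d n) = gcd e n * (n div gcd d n)" using h by (metis prod.inject)
    moreover have "n div gcd d n \<noteq> 0" using shift_order(2)[of d n] de by simp
    ultimately have "gcd d n = gcd e n" by (metis mult_right_cancel)
    then show "d = e" using h by (metis dvd_div_mult_self gcd_dvd1 prod.inject)
  qed
  moreover have "?h ` {d \<in> {0<..<n}. n div gcd d n \<le> k} \<subseteq> {1..k} \<times> {..<k}"
  proof clarify
    fix d assume d: "d \<in> {0<..<n}" "n div gcd d n \<le> k"
    have "n div gcd d n \<ge> 1" using shift_order(2)[of d n] d by simp
    moreover have "d div gcd d n < n div gcd d n"
      using d by (intro div_less_mono) auto
    ultimately show "n div gcd d n \<in> {1..k} \<and> d div gcd d n \<in> {..<k}" using d by simp
  qed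
  ultimately have "card {d \<in> {0<..<n}. n div gcd d n \<le> k} \<le> card ({1..k} \<times> {..<k})"
    by (rule card_inj_on_le) simp
  then show ?thesis by (simp add: power2_eq_square)
qed

lemma card_MSTD_odd_le:
  assumes "odd n"
  shows "real (card (MSTD (integer_mod_group n))) \<le> 1 / 2 * real n * \<phi> ^ n"
proof -
  have "real (card (MSTD (integer_mod_group n))) \<le> (\<Sum>d=1..n div 2. real (card (no_diff n d)))"
    using of_nat_mono[OF card_MSTD_le[OF odd_pos[OF assms]], where 'a = real] by simp
  also have "\<dots> \<le> (\<Sum>d=1..n div 2. \<phi> ^ n)"
    by (intro sum_mono card_no_diff_odd_le[OF assms]) auto
  also have "\<dots> = real (n div 2) * \<phi> ^ n" by simp
  also have "\<dots> \<le> (1 / 2 * real n) * \<phi> ^ n"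
    using golden_ratio_gt_1 by (intro mult_right_mono) auto
  finally show ?thesis by simp
qed

text \<open>The differences of order at most \<open>n powr (1/3)\<close> are discarded: that loses only \<open>n powr (2/3)\<close> of the
\<open>(n - 1)/2\<close> differences, while for the others the correction in \<open>card_no_diff_odd_ge\<close> is negligible.\<close>

lemma card_MSTD_odd_ge:
  assumes "odd n"
    and pos: "0 \<le> 1 - 2 * real n * (63 / 64) powr ((real n - 6) / 36)"
      "0 \<le> 1 - real n * \<phi> powr (- 2 * real n powr (1 / 3))"
  shows "real (card (MSTD (integer_mod_group n)))
    \<ge> (1 - 2 * real n * (63 / 64) powr ((real n - 6) / 36))
      * (((real n - 1) / 2 - real n powr (2 / 3))
      * ((1 - real n * \<phi> powr (- 2 * real n powr (1 / 3))) * \<phi> ^ n))"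
proof -
  define M where "M = real n powr (1 / 3)"
  define k where "k = nat \<lfloor>M\<rfloor>"
  define H where "H = {d \<in> {1..n div 2}. n div gcd d n > k}"
  have "n > 0" using assms(1) by (rule odd_pos)
  have "real k \<le> M" by (simp add: k_def M_def)
  have "card {1..n div 2} \<le> card H + card {d \<in> {0<..<n}. n div gcd d n \<le> k}"
  proof -
    have "{1..n div 2} \<subseteq> H \<union> {d \<in> {0<..<n}. n div gcd d n \<le> k}"
      using \<open>n > 0\<close> by (auto simp: H_def)
    then have "card {1..n div 2} \<le> card (H \<union> {d \<in> {0<..<n}. n div gcd d n \<le> k})"
      by (rule card_mono[rotated]) (simp add: H_def)
    then show ?thesis using card_Un_le order.trans by blast
  qed
  with card_small_order_le[of n k] have "n div 2 \<le> card H + k ^ 2" by simp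
  then have "real (n div 2) \<le> real (card H) + real k ^ 2"
    by (metis of_nat_add of_nat_mono of_nat_power)
  moreover have "real (n div 2) = (real n - 1) / 2" using assms(1) by (auto elim!: oddE)
  moreover have "real k ^ 2 \<le> real n powr (2 / 3)"
  proof -
    have "real k ^ 2 \<le> M ^ 2" using \<open>real k \<le> M\<close> by (intro power_mono) auto
    also have "\<dots> = real n powr (2 / 3)"
      using \<open>n > 0\<close> by (simp add: M_def power2_eq_square powr_add[symmetric])
    finally show ?thesis .
  qed
  ultimately have H: "(real n - 1) / 2 - real n powr (2 / 3) \<le> real (card H)" by linarith
  have "(\<Sum>d\<in>H. (1 - real n * \<phi> powr (- 2 * M)) * \<phi> ^ n) \<le> (\<Sum>d\<in>H. real (card (no_diff n d)))"
  proof (rule sum_mono)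
    fix d assume d: "d \<in> H"
    then have "M \<le> real (n div gcd d n)" by (simp add: H_def k_def) linarith
    then show "(1 - real n * \<phi> powr (- 2 * M)) * \<phi> ^ n \<le> real (card (no_diff n d))"
      using d by (intro card_no_diff_odd_ge assms) (auto simp: H_def)
  qed
  moreover have "((real n - 1) / 2 - real n powr (2 / 3)) * ((1 - real n * \<phi> powr (- 2 * M)) * \<phi> ^ n)
      \<le> (\<Sum>d\<in>H. (1 - real n * \<phi> powr (- 2 * M)) * \<phi> ^ n)"
    using H pos(2) golden_ratio_gt_1 by (simp add: M_def mult_right_mono)
  ultimately have "((real n - 1) / 2 - real n powr (2 / 3)) * ((1 - real n * \<phi> powr (- 2 * M)) * \<phi> ^ n)
      \<le> (\<Sum>d\<in>H. real (card (no_diff n d)))" by linarith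
  from mult_left_mono[OF this pos(1)] show ?thesis
    using card_MSTD_ge[OF \<open>n > 0\<close>, of H] by (fastforce simp: H_def M_def)
qed

text \<open>The base must lie below \<open>\<surd>3\<close> for the use of this bound when \<open>n\<close> is even, and it must not lie below
the fourth root of \<open>7\<close> since \<open>L\<^sub>4 = 7\<close>. The value \<open>5/3\<close> satisfies both, and the recurrence preserves
the bound as \<open>5/3 + 1 \<le> (5/3)\<^sup>2\<close>.\<close>

lemma lucas_le:
  assumes "m \<ge> 3"
  shows "real (fib (m + 1) + fib (m - 1)) \<le> (5 / 3) ^ m"
proof -
  \<comment> \<open>\<open>L k\<close> is the Lucas number with index \<open>k + 3\<close>.\<close>
  define L where "L k = real (fib (k + 4) + fib (k + 2))" for k
  have "L k \<le> (5 / 3) ^ (k + 3)" for k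
  proof (induction k rule: fib.induct)
    case (3 k)
    have "L (Suc (Suc k)) = L (Suc k) + L k" by (simp add: L_def eval_nat_numeral)
    also have "\<dots> \<le> (5 / 3) ^ (Suc k + 3) + (5 / 3) ^ (k + 3)" using 3 by (rule add_mono)
    also have "\<dots> = (5 / 3) ^ (k + 3) * (8 / 3)" by (simp add: power_add eval_nat_numeral)
    also have "\<dots> \<le> (5 / 3) ^ (k + 3) * (5 / 3) ^ 2"
      by (intro mult_left_mono) (simp_all add: power2_eq_square)
    also have "\<dots> = (5 / 3) ^ (Suc (Suc k) + 3)" by (simp add: power_add eval_nat_numeral)
    finally show ?case .
  qed (simp_all add: L_def eval_nat_numeral)
  moreover have "m - 3 + 4 = m + 1" "m - 3 + 2 = m - 1" "m - 3 + 3 = m" using assms by simp_all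
  ultimately show ?thesis unfolding L_def by metis
qed

lemma card_no_diff_le:
  assumes "0 < d" "2 * d < n"
  shows "real (card (no_diff n d)) \<le> (5 / 3) ^ n"
proof -
  define m where "m = n div gcd d n"
  have m: "gcd d n * m = n" "m \<ge> 3" using shift_order[of d n] assms by (simp_all add: m_def)
  have "real (fib (m + 1) + fib (m - 1)) ^ gcd d n \<le> ((5 / 3) ^ m) ^ gcd d n"
    using lucas_le[OF m(2)] by (intro power_mono) auto
  also have "\<dots> = (5 / 3) ^ n" by (metis m(1) mult.commute power_mult)
  finally show ?thesis using card_no_diff[of d n] assms by (simp add: m_def)
qed

lemma card_no_diff_half:
  assumes "even n" "n > 0"
  shows "real (card (no_diff n (n div 2))) = 3 powr (real n / 2)"
proof -
  obtain h where h: "n = 2 * h" "h > 0" using assms by (auto elim!: evenE)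
  have "card (no_diff n h) = (fib 3 + fib 1) ^ h"
    using card_no_diff[of h n] h by (simp add: numeral_3_eq_3)
  also have "fib 3 + fib 1 = 3" by (simp add: eval_nat_numeral)
  finally show ?thesis using h by (simp add: powr_realpow)
qed

lemma card_MSTD_even_le:
  assumes "even n" "n > 0"
  shows "real (card (MSTD (integer_mod_group n))) \<le> 3 powr (real n / 2) + real n * (5 / 3) ^ n"
proof -
  have "{1..n div 2} = insert (n div 2) {0<..<n div 2}" using assms by (auto elim!: evenE)
  then have "real (card (MSTD (integer_mod_group n)))
      \<le> real (card (no_diff n (n div 2))) + (\<Sum>d\<in>{0<..<n div 2}. real (card (no_diff n d)))"
    using of_nat_mono[OF card_MSTD_le[OF assms(2)], where 'a = real] by simp
  also have "(\<Sum>d\<in>{0<..<n div 2}. real (card (no_diff n d))) \<le> (\<Sum>d\<in>{0<..<n div 2}. (5 / 3) ^ n)"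
    using assms by (intro sum_mono card_no_diff_le) auto
  also have "\<dots> = real (card {0<..<n div 2}) * (5 / 3) ^ n" by simp
  also have "\<dots> \<le> real n * (5 / 3) ^ n" by (intro mult_right_mono) auto
  finally show ?thesis by (simp add: card_no_diff_half assms)
qed

lemma card_MSTD_even_ge:
  assumes "even n" "n > 0"
  shows "real (card (MSTD (integer_mod_group n)))
    \<ge> (1 - 2 * real n * (63 / 64) powr ((real n - 6) / 36)) * 3 powr (real n / 2)"
  using card_MSTD_ge[of n "{n div 2}"] assms by (auto simp: card_no_diff_half elim!: evenE)

theorem corollary1p2:
  shows "(\<lambda>n::nat. real (card (MSTD (integer_mod_group n)))) \<sim>[at_top]
         (\<lambda>n. if even n then 3 powr (real n / 2)
              else 1 / 2 * real n * ((1 + sqrt 5) / 2) ^ n)"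
proof -
  define a where "a n = real (card (MSTD (integer_mod_group n)))" for n
  define b where "b n = (if even n then 3 powr (real n / 2) else 1 / 2 * real n * \<phi> ^ n)" for n :: nat
  \<comment> \<open>The ratio \<open>a n / b n\<close> is at most \<open>t n\<close>. It is at least \<open>p n\<close> (even \<open>n\<close>) or \<open>p n * (r n * q n)\<close>
    (odd \<open>n\<close>): \<open>p\<close> is the loss to a second constraint, \<open>q\<close> the deviation of the Lucas numbers from powers of \<open>\<phi>\<close>,
    \<open>r\<close> the loss of the differences of small order.\<close>
  define p where "p n = 1 - 2 * real n * (63 / 64) powr ((real n - 6) / 36)" for n :: nat
  define q where "q n = 1 - real n * \<phi> powr (- 2 * real n powr (1 / 3))" for n :: nat
  define r where "r n = ((real n - 1) / 2 - real n powr (2 / 3)) / (1 / 2 * real n)" for n :: nat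
  define t where "t n = 1 + real n * (5 / 3 / sqrt 3) ^ n" for n :: nat
  have p: "p \<longlonglongrightarrow> 1" unfolding p_def by real_asymp
  have "(\<lambda>n. 1 - real n * c powr (- 2 * real n powr (1 / 3))) \<longlonglongrightarrow> 1" if "c > 1" for c :: real
    using that by real_asymp
  from this[OF golden_ratio_gt_1] have q: "q \<longlonglongrightarrow> 1" by (simp only: q_def[abs_def])
  have r: "r \<longlonglongrightarrow> 1" unfolding r_def by real_asymp
  have "5 / 3 < sqrt 3" by (rule real_less_rsqrt) (simp add: power2_eq_square)
  then have "(\<lambda>n. real n * (5 / 3 / sqrt 3) ^ n) \<longlonglongrightarrow> 0"
    by (intro powser_times_n_limit_0) simp
  from tendsto_add[OF tendsto_const[of 1] this] have t: "t \<longlonglongrightarrow> 1" by (simp add: t_def[abs_def])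
  have b: "b n > 0" if "n > 0" for n
    using that golden_ratio_gt_1 by (auto simp: b_def)
  have upper: "a n / b n \<le> t n" if "n > 0" for n
  proof (cases "even n")
    case True
    have "sqrt 3 ^ n = 3 powr (real n / 2)"
      by (simp add: powr_half_sqrt[symmetric] powr_realpow[symmetric] powr_powr)
    then have "t n * b n = 3 powr (real n / 2) + real n * (5 / 3) ^ n"
      using True by (simp add: t_def b_def power_divide field_simps)
    then show ?thesis
      using card_MSTD_even_le[OF True that] b[OF that] by (simp add: a_def pos_divide_le_eq)
  next
    case False
    then have "a n / b n \<le> 1"
      using card_MSTD_odd_le[OF False] b[OF that] by (simp add: a_def b_def)
    also have "1 \<le> t n" by (simp add: t_def)
    finally show ?thesis .
  qed
  have lower: "(if even n then p n else p n * (r n * q n)) \<le> a n / b n"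
    if "n > 0" "p n > 0" "q n > 0" for n
  proof (cases "even n")
    case True
    then show ?thesis using card_MSTD_even_ge[OF True \<open>n > 0\<close>] by (simp add: a_def b_def p_def field_simps)
  next
    case False
    have "p n * (r n * q n) * b n = p n * (((real n - 1) / 2 - real n powr (2 / 3)) * (q n * \<phi> ^ n))"
      using False \<open>n > 0\<close> by (simp add: b_def r_def)
    also have "\<dots> \<le> a n"
      using card_MSTD_odd_ge[OF False] that by (simp add: a_def p_def q_def)
    finally show ?thesis using False b[OF \<open>n > 0\<close>] by (simp add: pos_le_divide_eq)
  qed
  have "(\<lambda>n. p n * (r n * q n)) \<longlonglongrightarrow> 1 * (1 * 1)" by (intro tendsto_mult p q r)
  then have lim: "(\<lambda>n. if even n then p n else p n * (r n * q n)) \<longlonglongrightarrow> 1"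
    using p by (intro filterlim_If) (auto intro: filterlim_mono inf_le1)
  have lo: "\<forall>\<^sub>F n in sequentially. (if even n then p n else p n * (r n * q n)) \<le> a n / b n"
    using eventually_gt_at_top[of 0] order_tendstoD(1)[OF p zero_less_one] order_tendstoD(1)[OF q zero_less_one]
    by eventually_elim (simp_all add: lower)
  have up: "\<forall>\<^sub>F n in sequentially. a n / b n \<le> t n"
    using eventually_gt_at_top[of 0] by eventually_elim (rule upper)
  have "(\<lambda>n. a n / b n) \<longlonglongrightarrow> 1" by (rule tendsto_sandwich[OF lo up lim t])
  then have "a \<sim>[at_top] b" by (rule asymp_equivI')
  then show ?thesis by (simp only: a_def[abs_def] b_def[abs_def] \<phi>_def)
qed

end
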